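(* There is a category isomorphism between the category of ordered Ehresmann semigroups satisfying (OS4) and the category of Ehresmann-ordered categories satisfying (OC4). Similarly, there is a category isomorphism between the category of ordered Ehresmann semigroups satisfying (OS7) and the category of Ehresmann-ordered categories satisfying (OC7). Here the conditions are: (OS4) for all $s,t$ in the semigroup $S$, if $s\leq t$, $D(s)=D(t)$ and $R(s)=R(t)$, then $s=t$; (OC4) for all $a,b$ in the category $C$, if $a\leq b$, $D(a)=D(b)$ and $R(a)=R(b)$, then $a=b$; (OS7) for all $u,s,t\in S$, if $u\leq st$ then there are $s'\leq s$, $t'\leq t$ for which $u=s't'$; (OC7) for all $a,b,c\in C$, if $b\circ c$ exists and $a\leq b\circ c$, then there are $b'\leq b$, $c'\leq c$ such that $b'\circ c'$ exists and $a=b'\circ c'$.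
   Context: An Ehresmann semigroup is a semigroup $(S,\cdot)$ with unary operations $D,R$ such that for all $s,t\in S$: $D(s)s=s$, $sR(s)=s$; $D(R(s))=R(s)$, $R(D(s))=D(s)$; $D(st)=D(sD(t))$, $R(st)=R(R(s)t)$; $D(D(s)D(t))=D(s)D(t)$; $D(s)D(t)=D(t)D(s)$. Put $D(S)=\{D(s)\mid s\in S\}=R(S)$. An ordered Ehresmann semigroup $(S,\cdot,D,R,\leq)$ is an Ehresmann semigroup with a partial order $\leq$ on $S$ such that: $a\leq b$ implies $D(a)\leq D(b)$ and $R(a)\leq R(b)$; $a\leq b$ and $c\leq d$ imply $ac\leq bd$; $ae\leq a$ and $ea\leq a$ for all $a\in S$, $e\in D(S)$; and if $a\in S$, $e\in D(S)$ and $a\leq e$ then $a\in D(S)$. The arrows of the category of ordered Ehresmann semigroups (and of the subcategories considered) are the ordered Ehresmann semigroup homomorphisms: semigroup homomorphisms $F:S\to T$ with $D(s)F=D(sF)$, $R(s)F=R(sF)$ for all $s\in S$, and such that $s\leq t$ implies $sF\leq tF$. (Functions are written on the right.) A (small) category is a partial algebra $(C,\circ,D,R)$ with $\circ$ a partial binary operation and $D,R$ unary operations such that for all $x,y,z\in C$: $D(x)\circ x=x=x\circ R(x)$; $D(R(x))=R(x)$, $R(D(x))=D(x)$; $x\circ y$ is defined iff $R(x)=D(y)$; if $x\circ y$ is defined then $D(x\circ y)=D(x)$ and $R(x\circ y)=R(y)$; if $(x\circ y)\circ z$ and $x\circ(y\circ z)$ are defined they are equal. $D(C)=\{D(x)\mid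 x\in C\}=R(C)$ is the set of identities. An $\Omega$-structured category $(C,\circ,D,R,\leq)$ is a category with a partial order $\leq$ on $C$ such that $a\leq b$ implies $D(a)\leq D(b)$ and $R(a)\leq R(b)$; and if $a\leq b$, $c\leq d$ and both $a\circ c$, $b\circ d$ exist, then $a\circ c\leq b\circ d$. An Ehresmann-ordered category is an $\Omega$-structured category $(C,\circ,D,R,\leq)$ such that: (OC6) for all $x\in C$ and $e\in D(C)$ with $e\leq D(x)$, there is a greatest element $e|x=\max\{y\leq x\mid D(y)\leq e\}$, and $D(e|x)=e$; and for all $x\in C$ and $e\in D(C)$ with $e\leq R(x)$, there is a greatest element $x|e=\max\{y\leq x\mid R(y)\leq e\}$, and $R(x|e)=e$; (OC7') if $a\leq b\circ c$, then there are $b'\leq b$, $c'\leq c$ such that $D(a)=D(b')$, $R(a)=R(c')$, $b'\circ c'$ exists, and $a\leq b'\circ c'$; (OCI) if $a\in C$ and $a\leq e\in D(C)$, then $a\in D(C)$; and $(D(C),\leq)$ is a meet-semilattice (with meet $\wedge$). The arrows of the category of Ehresmann-ordered categories (and of the subcategories considered) are the morphisms of Ehresmann-ordered categories: functors $F:C_1\to C_2$ (maps preserving $D$, $R$ and all existing products $\circ$) such that: $s\leq t$ implies $sF\leq tF$; $(e\wedge f)F=eF\wedge fF$ for $e,f\in D(C_1)$; if $s\in C_1$, $e\in D(C_1)$ and $e\leq D(s)$ then $(e|s)F=(eF)|(sF)$, and dually if $f\in D(C_1)$ and $f\leq R(s)$ then $(s|f)F=(sF)|(fF)$. *)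

theory Defs
  imports Main "HOL-Library.FuncSet"
begin

text \<open>
  Structures live on a carrier set inside a type. All operations are extensional, that is, they
  have a fixed value outside the carrier (\<^term>\<open>undefined\<close>, or \<^term>\<open>None\<close> for the partial
  product), so that two records are equal exactly when the structures they represent are equal.
  An isomorphism of categories is a bijection on objects, so it is sensitive to this.
  The empty structure is not excluded.
\<close>

record 'a biunary =
  carrier :: "'a set"
  Dop :: "'a \<Rightarrow> 'a"  ("\<D>\<index>")
  Rop :: "'a \<Rightarrow> 'a"  ("\<R>\<index>")

definition idents :: "('a, 'b) biunary_scheme \<Rightarrow> 'a set" where
  "idents X = Dop X ` carrier X"


section \<open>Ordered Ehresmann semigroups\<close>

record 'a ehresmann_sgp = "'a biunary" +
  mult :: "'a \<Rightarrow> 'a \<Rightarrow> 'a"  (infixl "\<cdot>\<index>" 70)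

record 'a ordered_sgp = "'a ehresmann_sgp" +
  sle :: "'a \<Rightarrow> 'a \<Rightarrow> bool"  (infix "\<sqsubseteq>\<index>" 50)

locale ehresmann_semigroup =
  fixes S (structure)
  assumes D_closed: "\<D> \<in> carrier S \<rightarrow>\<^sub>E carrier S"
    and R_closed: "\<R> \<in> carrier S \<rightarrow>\<^sub>E carrier S"
    and mult_closed: "case_prod (mult S) \<in> carrier S \<times> carrier S \<rightarrow>\<^sub>E carrier S"
    and mult_assoc:
      "\<lbrakk>s \<in> carrier S; t \<in> carrier S; u \<in> carrier S\<rbrakk> \<Longrightarrow> (s \<cdot> t) \<cdot> u = s \<cdot> (t \<cdot> u)"
    and D_left: "s \<in> carrier S \<Longrightarrow> \<D> s \<cdot> s = s"
    and R_right: "s \<in> carrier S \<Longrightarrow> s \<cdot> \<R> s = s"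
    and D_R: "s \<in> carrier S \<Longrightarrow> \<D> (\<R> s) = \<R> s"
    and R_D: "s \<in> carrier S \<Longrightarrow> \<R> (\<D> s) = \<D> s"
    and D_mult: "\<lbrakk>s \<in> carrier S; t \<in> carrier S\<rbrakk> \<Longrightarrow> \<D> (s \<cdot> t) = \<D> (s \<cdot> \<D> t)"
    and R_mult: "\<lbrakk>s \<in> carrier S; t \<in> carrier S\<rbrakk> \<Longrightarrow> \<R> (s \<cdot> t) = \<R> (\<R> s \<cdot> t)"
    and D_mult_D: "\<lbrakk>s \<in> carrier S; t \<in> carrier S\<rbrakk> \<Longrightarrow> \<D> (\<D> s \<cdot> \<D> t) = \<D> s \<cdot> \<D> t"
    and D_commute: "\<lbrakk>s \<in> carrier S; t \<in> carrier S\<rbrakk> \<Longrightarrow> \<D> s \<cdot> \<D> t = \<D> t \<cdot> \<D> s"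

locale ordered_ehresmann_semigroup = ehresmann_semigroup S
  for S :: "('a, 'b) ordered_sgp_scheme" (structure) +
  assumes sle_carrier: "a \<sqsubseteq> b \<Longrightarrow> a \<in> carrier S \<and> b \<in> carrier S"
    and sle_refl: "a \<in> carrier S \<Longrightarrow> a \<sqsubseteq> a"
    and sle_antisym: "\<lbrakk>a \<sqsubseteq> b; b \<sqsubseteq> a\<rbrakk> \<Longrightarrow> a = b"
    and sle_trans: "\<lbrakk>a \<sqsubseteq> b; b \<sqsubseteq> c\<rbrakk> \<Longrightarrow> a \<sqsubseteq> c"
    and D_mono: "a \<sqsubseteq> b \<Longrightarrow> \<D> a \<sqsubseteq> \<D> b"
    and R_mono: "a \<sqsubseteq> b \<Longrightarrow> \<R> a \<sqsubseteq> \<R> b"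
    and mult_mono: "\<lbrakk>a \<sqsubseteq> b; c \<sqsubseteq> d\<rbrakk> \<Longrightarrow> a \<cdot> c \<sqsubseteq> b \<cdot> d"
    and mult_ident_right: "\<lbrakk>a \<in> carrier S; e \<in> idents S\<rbrakk> \<Longrightarrow> a \<cdot> e \<sqsubseteq> a"
    and mult_ident_left: "\<lbrakk>a \<in> carrier S; e \<in> idents S\<rbrakk> \<Longrightarrow> e \<cdot> a \<sqsubseteq> a"
    and idents_down: "\<lbrakk>a \<in> carrier S; e \<in> idents S; a \<sqsubseteq> e\<rbrakk> \<Longrightarrow> a \<in> idents S"

definition OES_hom :: "'a ordered_sgp \<Rightarrow> 'a ordered_sgp \<Rightarrow> ('a \<Rightarrow> 'a) \<Rightarrow> bool" where
  "OES_hom S T F \<longleftrightarrow>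
     F \<in> carrier S \<rightarrow>\<^sub>E carrier T \<and>
     (\<forall>s\<in>carrier S. \<forall>t\<in>carrier S. F (s \<cdot>\<^bsub>S\<^esub> t) = F s \<cdot>\<^bsub>T\<^esub> F t) \<and>
     (\<forall>s\<in>carrier S. F (\<D>\<^bsub>S\<^esub> s) = \<D>\<^bsub>T\<^esub> (F s) \<and> F (\<R>\<^bsub>S\<^esub> s) = \<R>\<^bsub>T\<^esub> (F s)) \<and>
     (\<forall>s t. s \<sqsubseteq>\<^bsub>S\<^esub> t \<longrightarrow> F s \<sqsubseteq>\<^bsub>T\<^esub> F t)"

definition OS4 :: "'a ordered_sgp \<Rightarrow> bool" where
  "OS4 S \<longleftrightarrow>
     (\<forall>s\<in>carrier S. \<forall>t\<in>carrier S.
        s \<sqsubseteq>\<^bsub>S\<^esub> t \<and> \<D>\<^bsub>S\<^esub> s = \<D>\<^bsub>S\<^esub> t \<and> \<R>\<^bsub>S\<^esub> s = \<R>\<^bsub>S\<^esub> t \<longrightarrow> s = t)"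

definition OS7 :: "'a ordered_sgp \<Rightarrow> bool" where
  "OS7 S \<longleftrightarrow>
     (\<forall>u\<in>carrier S. \<forall>s\<in>carrier S. \<forall>t\<in>carrier S.
        u \<sqsubseteq>\<^bsub>S\<^esub> s \<cdot>\<^bsub>S\<^esub> t \<longrightarrow> (\<exists>s' t'. s' \<sqsubseteq>\<^bsub>S\<^esub> s \<and> t' \<sqsubseteq>\<^bsub>S\<^esub> t \<and> u = s' \<cdot>\<^bsub>S\<^esub> t'))"


section \<open>Categories as partial algebras\<close>

text \<open>
  Products are in diagrammatic order: \<open>x \<circ> y\<close> is defined iff \<open>R(x) = D(y)\<close>. The value
  \<^term>\<open>None\<close> means that the product does not exist.
\<close>

record 'a cat = "'a biunary" +
  pcomp :: "'a \<Rightarrow> 'a \<Rightarrow> 'a option"  (infixl "\<odot>\<index>" 70)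

record 'a ordered_cat = "'a cat" +
  cle :: "'a \<Rightarrow> 'a \<Rightarrow> bool"  (infix "\<preceq>\<index>" 50)

locale category =
  fixes C (structure)
  assumes D_closed: "\<D> \<in> carrier C \<rightarrow>\<^sub>E carrier C"
    and R_closed: "\<R> \<in> carrier C \<rightarrow>\<^sub>E carrier C"
    and comp_closed: "x \<odot> y = Some z \<Longrightarrow> z \<in> carrier C"
    and comp_defined: "(\<exists>z. x \<odot> y = Some z) \<longleftrightarrow> x \<in> carrier C \<and> y \<in> carrier C \<and> \<R> x = \<D> y"
    and D_left: "x \<in> carrier C \<Longrightarrow> \<D> x \<odot> x = Some x"
    and R_right: "x \<in> carrier C \<Longrightarrow> x \<odot> \<R> x = Some x"
    and D_R: "x \<in> carrier C \<Longrightarrow> \<D> (\<R> x) = \<R> x"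
    and R_D: "x \<in> carrier C \<Longrightarrow> \<R> (\<D> x) = \<D> x"
    and D_comp: "x \<odot> y = Some z \<Longrightarrow> \<D> z = \<D> x"
    and R_comp: "x \<odot> y = Some z \<Longrightarrow> \<R> z = \<R> y"
    and comp_assoc:
      "\<lbrakk>x \<odot> y = Some u; u \<odot> z = Some v; y \<odot> z = Some w; x \<odot> w = Some v'\<rbrakk> \<Longrightarrow> v = v'"

definition is_functor ::
  "('a, 'c) cat_scheme \<Rightarrow> ('b, 'd) cat_scheme \<Rightarrow> ('a \<Rightarrow> 'b) \<Rightarrow> bool" where
  "is_functor C1 C2 F \<longleftrightarrow>
     F \<in> carrier C1 \<rightarrow>\<^sub>E carrier C2 \<and>
     (\<forall>x\<in>carrier C1. F (\<D>\<^bsub>C1\<^esub> x) = \<D>\<^bsub>C2\<^esub> (F x) \<and> F (\<R>\<^bsub>C1\<^esub> x) = \<R>\<^bsub>C2\<^esub> (F x)) \<and>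
     (\<forall>x y z. x \<odot>\<^bsub>C1\<^esub> y = Some z \<longrightarrow> F x \<odot>\<^bsub>C2\<^esub> F y = Some (F z))"

definition isomorphic_categories :: "('a, 'c) cat_scheme \<Rightarrow> ('b, 'd) cat_scheme \<Rightarrow> bool" where
  "isomorphic_categories C1 C2 \<longleftrightarrow>
     category C1 \<and> category C2 \<and>
     (\<exists>F G. is_functor C1 C2 F \<and> is_functor C2 C1 G \<and>
        (\<forall>x\<in>carrier C1. G (F x) = x) \<and> (\<forall>y\<in>carrier C2. F (G y) = y))"


section \<open>Ehresmann-ordered categories\<close>

locale omega_structured_category = category C
  for C :: "('a, 'b) ordered_cat_scheme" (structure) +
  assumes cle_carrier: "a \<preceq> b \<Longrightarrow> a \<in> carrier C \<and> b \<in> carrier C"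
    and cle_refl: "a \<in> carrier C \<Longrightarrow> a \<preceq> a"
    and cle_antisym: "\<lbrakk>a \<preceq> b; b \<preceq> a\<rbrakk> \<Longrightarrow> a = b"
    and cle_trans: "\<lbrakk>a \<preceq> b; b \<preceq> c\<rbrakk> \<Longrightarrow> a \<preceq> c"
    and D_mono: "a \<preceq> b \<Longrightarrow> \<D> a \<preceq> \<D> b"
    and R_mono: "a \<preceq> b \<Longrightarrow> \<R> a \<preceq> \<R> b"
    and comp_mono: "\<lbrakk>a \<preceq> b; c \<preceq> d; a \<odot> c = Some x; b \<odot> d = Some y\<rbrakk> \<Longrightarrow> x \<preceq> y"

definition is_greatest :: "('a, 'b) ordered_cat_scheme \<Rightarrow> 'a set \<Rightarrow> 'a \<Rightarrow> bool" where
  "is_greatest C A m \<longleftrightarrow> m \<in> A \<and> (\<forall>y\<in>A. y \<preceq>\<^bsub>C\<^esub> m)"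

text \<open>
  The sets whose maxima are the restriction \<open>e|x\<close>, the corestriction \<open>x|e\<close>, and the meet
  of two identities.
\<close>

definition res_set :: "('a, 'b) ordered_cat_scheme \<Rightarrow> 'a \<Rightarrow> 'a \<Rightarrow> 'a set" where
  "res_set C e x = {y. y \<preceq>\<^bsub>C\<^esub> x \<and> \<D>\<^bsub>C\<^esub> y \<preceq>\<^bsub>C\<^esub> e}"

definition cores_set :: "('a, 'b) ordered_cat_scheme \<Rightarrow> 'a \<Rightarrow> 'a \<Rightarrow> 'a set" where
  "cores_set C x e = {y. y \<preceq>\<^bsub>C\<^esub> x \<and> \<R>\<^bsub>C\<^esub> y \<preceq>\<^bsub>C\<^esub> e}"

definition lower_idents :: "('a, 'b) ordered_cat_scheme \<Rightarrow> 'a \<Rightarrow> 'a \<Rightarrow> 'a set" where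
  "lower_idents C e f = {g \<in> idents C. g \<preceq>\<^bsub>C\<^esub> e \<and> g \<preceq>\<^bsub>C\<^esub> f}"

definition res :: "('a, 'b) ordered_cat_scheme \<Rightarrow> 'a \<Rightarrow> 'a \<Rightarrow> 'a" where
  "res C e x = (THE m. is_greatest C (res_set C e x) m)"

definition cores :: "('a, 'b) ordered_cat_scheme \<Rightarrow> 'a \<Rightarrow> 'a \<Rightarrow> 'a" where
  "cores C x e = (THE m. is_greatest C (cores_set C x e) m)"

definition meet :: "('a, 'b) ordered_cat_scheme \<Rightarrow> 'a \<Rightarrow> 'a \<Rightarrow> 'a" where
  "meet C e f = (THE m. is_greatest C (lower_idents C e f) m)"

locale ehresmann_ordered_category = omega_structured_category +
  assumes OC6_left:
      "\<lbrakk>x \<in> carrier C; e \<in> idents C; e \<preceq> \<D> x\<rbrakk> \<Longrightarrow>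
        \<exists>m. is_greatest C (res_set C e x) m \<and> \<D> m = e"
    and OC6_right:
      "\<lbrakk>x \<in> carrier C; e \<in> idents C; e \<preceq> \<R> x\<rbrakk> \<Longrightarrow>
        \<exists>m. is_greatest C (cores_set C x e) m \<and> \<R> m = e"
    and OC7':
      "\<lbrakk>b \<odot> c = Some d; a \<preceq> d\<rbrakk> \<Longrightarrow>
        \<exists>b' c' d'. b' \<preceq> b \<and> c' \<preceq> c \<and> \<D> a = \<D> b' \<and> \<R> a = \<R> c' \<and> b' \<odot> c' = Some d' \<and> a \<preceq> d'"
    and OCI: "\<lbrakk>a \<in> carrier C; e \<in> idents C; a \<preceq> e\<rbrakk> \<Longrightarrow> a \<in> idents C"
    and idents_meet:
      "\<lbrakk>e \<in> idents C; f \<in> idents C\<rbrakk> \<Longrightarrow> \<exists>m. is_greatest C (lower_idents C e f) m"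

definition EOC_hom :: "'a ordered_cat \<Rightarrow> 'a ordered_cat \<Rightarrow> ('a \<Rightarrow> 'a) \<Rightarrow> bool" where
  "EOC_hom C1 C2 F \<longleftrightarrow>
     is_functor C1 C2 F \<and>
     (\<forall>s t. s \<preceq>\<^bsub>C1\<^esub> t \<longrightarrow> F s \<preceq>\<^bsub>C2\<^esub> F t) \<and>
     (\<forall>e\<in>idents C1. \<forall>f\<in>idents C1. F (meet C1 e f) = meet C2 (F e) (F f)) \<and>
     (\<forall>s\<in>carrier C1. \<forall>e\<in>idents C1. e \<preceq>\<^bsub>C1\<^esub> \<D>\<^bsub>C1\<^esub> s \<longrightarrow> F (res C1 e s) = res C2 (F e) (F s)) \<and>
     (\<forall>s\<in>carrier C1. \<forall>f\<in>idents C1. f \<preceq>\<^bsub>C1\<^esub> \<R>\<^bsub>C1\<^esub> s \<longrightarrow> F (cores C1 s f) = cores C2 (F s) (F f))"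

definition OC4 :: "'a ordered_cat \<Rightarrow> bool" where
  "OC4 C \<longleftrightarrow>
     (\<forall>a\<in>carrier C. \<forall>b\<in>carrier C.
        a \<preceq>\<^bsub>C\<^esub> b \<and> \<D>\<^bsub>C\<^esub> a = \<D>\<^bsub>C\<^esub> b \<and> \<R>\<^bsub>C\<^esub> a = \<R>\<^bsub>C\<^esub> b \<longrightarrow> a = b)"

definition OC7 :: "'a ordered_cat \<Rightarrow> bool" where
  "OC7 C \<longleftrightarrow>
     (\<forall>a b c d. b \<odot>\<^bsub>C\<^esub> c = Some d \<and> a \<preceq>\<^bsub>C\<^esub> d \<longrightarrow>
        (\<exists>b' c'. b' \<preceq>\<^bsub>C\<^esub> b \<and> c' \<preceq>\<^bsub>C\<^esub> c \<and> b' \<odot>\<^bsub>C\<^esub> c' = Some a))"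


section \<open>The two categories of structures\<close>

text \<open>
  The category with objects the structures satisfying \<open>obj\<close> and arrows the maps satisfying
  \<open>hom\<close>, itself presented as a partial algebra: an arrow is a triple (source, map, target), and
  the object \<open>X\<close> is represented by its identity arrow. Carriers of objects range over the subsets
  of the type \<open>'a\<close>, which plays the role of the universe.
\<close>

definition structure_category ::
  "(('a, 'b) biunary_scheme \<Rightarrow> bool) \<Rightarrow>
   (('a, 'b) biunary_scheme \<Rightarrow> ('a, 'b) biunary_scheme \<Rightarrow> ('a \<Rightarrow> 'a) \<Rightarrow> bool) \<Rightarrow>
   (('a, 'b) biunary_scheme \<times> ('a \<Rightarrow> 'a) \<times> ('a, 'b) biunary_scheme) cat" where
  "structure_category obj hom =
    (let A = {(X, F, Y). obj X \<and> obj Y \<and> hom X Y F};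
         ident = (\<lambda>X. (X, restrict id (carrier X), X))
     in \<lparr>carrier = A,
         Dop = restrict (\<lambda>(X, F, Y). ident X) A,
         Rop = restrict (\<lambda>(X, F, Y). ident Y) A,
         pcomp = (\<lambda>(X, F, Y) (Y', G, Z).
           if (X, F, Y) \<in> A \<and> (Y', G, Z) \<in> A \<and> Y = Y'
           then Some (X, compose (carrier X) G F, Z) else None)\<rparr>)"

definition OES_category ::
  "('a ordered_sgp \<Rightarrow> bool) \<Rightarrow> ('a ordered_sgp \<times> ('a \<Rightarrow> 'a) \<times> 'a ordered_sgp) cat" where
  "OES_category P = structure_category (\<lambda>S. ordered_ehresmann_semigroup S \<and> P S) OES_hom"

definition EOC_category ::
  "('a ordered_cat \<Rightarrow> bool) \<Rightarrow> ('a ordered_cat \<times> ('a \<Rightarrow> 'a) \<times> 'a ordered_cat) cat" where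
  "EOC_category P = structure_category (\<lambda>C. ehresmann_ordered_category C \<and> P C) EOC_hom"

end

theory Submission
  imports Defs
begin

text \<open>
  From an ordered Ehresmann semigroup one obtains a category by keeping only the products \<open>st\<close>
  with \<open>R(s) = D(t)\<close>. Nothing is lost: \<open>st = (se)(et)\<close> for \<open>e = R(s)D(t)\<close>, and the two factors
  on the right match (\<open>mult_via_overlap\<close>). In this category the meet of two identities is their
  product, and \<open>e|x\<close> and \<open>x|e\<close> are \<open>ex\<close> and \<open>xe\<close>, so it is Ehresmann-ordered and it determines
  the semigroup.

  Conversely, an Ehresmann-ordered category is given the total product
  \<open>s \<otimes> t = (s|e) \<circ> (e|t)\<close> with \<open>e = R(s) \<and> D(t)\<close>. This is the greatest element among the
  composites \<open>x \<circ> y\<close> with \<open>x \<le> s\<close> and \<open>y \<le> t\<close> (\<open>sgp_mult_attained\<close> and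
  \<open>sgp_mult_upper_bound\<close>), and this description yields nearly all the semigroup axioms.
  Associativity is the delicate one. By definition \<open>(s \<otimes> t) \<otimes> u\<close> is some \<open>a \<circ> z\<close> with
  \<open>a \<le> s \<otimes> t\<close>; to compare it with the other bracketing, \<open>a\<close> itself has to be a composite of
  elements below \<open>s\<close> and \<open>t\<close>, which is what (OC7) provides. Under (OC4) the element \<open>b' \<circ> c'\<close>
  of (OC7') lies above \<open>a\<close> and has the same domain and range, hence equals \<open>a\<close>. So (OC4) implies
  (OC7), and one argument serves both parts of the theorem.

  The two constructions undo each other and keep carriers, and a map is a homomorphism of
  semigroups exactly when it is a morphism of the associated categories
  (\<open>OES_hom_iff_EOC_hom\<close>). Such a bijection on objects that leaves the maps alone is an
  isomorphism of the categories of structures.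
\<close>

section \<open>Identities and restrictions in an ordered Ehresmann semigroup\<close>

context ehresmann_semigroup
begin

lemma D_in [simp]: "s \<in> carrier S \<Longrightarrow> \<D> s \<in> carrier S"
  using D_closed by (rule PiE_mem)

lemma R_in [simp]: "s \<in> carrier S \<Longrightarrow> \<R> s \<in> carrier S"
  using R_closed by (rule PiE_mem)

lemma mult_in [simp]: "\<lbrakk>s \<in> carrier S; t \<in> carrier S\<rbrakk> \<Longrightarrow> s \<cdot> t \<in> carrier S"
  using PiE_mem[OF mult_closed, of "(s, t)"] by simp

lemma ident_in [simp]: "e \<in> idents S \<Longrightarrow> e \<in> carrier S"
  by (auto simp: idents_def)

lemma R_ident [simp]: "e \<in> idents S \<Longrightarrow> \<R> e = e"
  by (auto simp: idents_def R_D)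

lemma D_ident [simp]: "e \<in> idents S \<Longrightarrow> \<D> e = e"
  by (metis D_R R_ident ident_in)

lemma D_idents [simp]: "s \<in> carrier S \<Longrightarrow> \<D> s \<in> idents S"
  unfolding idents_def by (rule imageI)

lemma R_idents [simp]: "s \<in> carrier S \<Longrightarrow> \<R> s \<in> idents S"
  by (metis D_R D_idents R_in)

lemma ident_idem [simp]: "e \<in> idents S \<Longrightarrow> e \<cdot> e = e"
  using D_left[of e] by simp

lemma ident_commute: "\<lbrakk>e \<in> idents S; f \<in> idents S\<rbrakk> \<Longrightarrow> e \<cdot> f = f \<cdot> e"
  using D_commute[of e f] by simp

lemma ident_mult [simp]: "\<lbrakk>e \<in> idents S; f \<in> idents S\<rbrakk> \<Longrightarrow> e \<cdot> f \<in> idents S"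
  using D_mult_D[of e f] D_idents[of "e \<cdot> f"] by simp

lemma D_ident_mult: "\<lbrakk>e \<in> idents S; x \<in> carrier S\<rbrakk> \<Longrightarrow> \<D> (e \<cdot> x) = e \<cdot> \<D> x"
  using D_mult[of e x] by simp

lemma R_mult_ident: "\<lbrakk>x \<in> carrier S; e \<in> idents S\<rbrakk> \<Longrightarrow> \<R> (x \<cdot> e) = \<R> x \<cdot> e"
  using R_mult[of x e] by simp

text \<open>
  The product of any two elements is a product of matching ones: cutting both factors down to
  the identity \<open>R(s)D(t)\<close> on which they overlap loses nothing, as \<open>s = sR(s)\<close> and \<open>t = D(t)t\<close>.
\<close>

lemma mult_via_overlap:
  assumes s: "s \<in> carrier S" and t: "t \<in> carrier S"
  shows "(s \<cdot> (\<R> s \<cdot> \<D> t)) \<cdot> ((\<R> s \<cdot> \<D> t) \<cdot> t) = s \<cdot> t"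
    and "\<R> (s \<cdot> (\<R> s \<cdot> \<D> t)) = \<R> s \<cdot> \<D> t"
    and "\<D> ((\<R> s \<cdot> \<D> t) \<cdot> t) = \<R> s \<cdot> \<D> t"
proof -
  let ?e = "\<R> s \<cdot> \<D> t"
  have e: "?e \<in> idents S" and Rs: "\<R> s \<in> idents S" and Dt: "\<D> t \<in> idents S"
    using s t by simp_all
  have 1: "s \<cdot> ?e = s \<cdot> \<D> t"
    using s t by (simp add: mult_assoc[symmetric] R_right)
  have 2: "?e \<cdot> t = \<R> s \<cdot> t"
    using s t by (simp add: mult_assoc D_left)
  have "(s \<cdot> \<D> t) \<cdot> (\<R> s \<cdot> t) = s \<cdot> ((\<D> t \<cdot> \<R> s) \<cdot> t)"
    using s t by (simp add: mult_assoc)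
  also have "\<D> t \<cdot> \<R> s = \<R> s \<cdot> \<D> t"
    using Rs Dt by (rule ident_commute[rotated])
  also have "s \<cdot> (\<R> s \<cdot> \<D> t \<cdot> t) = s \<cdot> (\<R> s \<cdot> t)"
    using 2 by simp
  also have "\<dots> = s \<cdot> t"
    using s t by (simp add: mult_assoc[symmetric] R_right)
  finally show "(s \<cdot> ?e) \<cdot> (?e \<cdot> t) = s \<cdot> t"
    unfolding 1 2 .
  show "\<R> (s \<cdot> ?e) = ?e"
    using 1 s Dt by (simp add: R_mult_ident)
  show "\<D> (?e \<cdot> t) = ?e"
    using 2 t Rs by (simp add: D_ident_mult)
qed

end

context ordered_ehresmann_semigroup
begin

lemma ident_below_mult:
  assumes "e \<in> idents S" "e \<sqsubseteq> f"
  shows "e \<sqsubseteq> e \<cdot> f"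
  using mult_mono[OF sle_refl assms(2), of e] assms(1) by simp

lemma ident_absorb:
  assumes "e \<in> idents S" "f \<in> idents S" "e \<sqsubseteq> f"
  shows "e \<cdot> f = e" and "f \<cdot> e = e"
proof -
  show "e \<cdot> f = e"
    using assms by (intro sle_antisym ident_below_mult mult_ident_right) auto
  then show "f \<cdot> e = e"
    using assms ident_commute by metis
qed

lemma ident_mult_greatest:
  assumes "g \<in> idents S" "g \<sqsubseteq> e" "g \<sqsubseteq> f"
  shows "g \<sqsubseteq> e \<cdot> f"
  using mult_mono[OF assms(2,3)] assms(1) by simp

end


section \<open>The ordered category of a semigroup\<close>

definition category_of :: "('a, 'b) ordered_sgp_scheme \<Rightarrow> 'a ordered_cat" where
  "category_of S =
     \<lparr>carrier = carrier S, Dop = Dop S, Rop = Rop S,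
      pcomp = (\<lambda>x y. if x \<in> carrier S \<and> y \<in> carrier S \<and> Rop S x = Dop S y
                     then Some (mult S x y) else None),
      cle = sle S\<rparr>"

lemma category_of_sel [simp]:
  "carrier (category_of S) = carrier S"
  "Dop (category_of S) = Dop S"
  "Rop (category_of S) = Rop S"
  "cle (category_of S) = sle S"
  "idents (category_of S) = idents S"
  by (simp_all add: category_of_def idents_def)

lemma pcomp_category_of:
  "pcomp (category_of S) x y = Some z \<longleftrightarrow>
     x \<in> carrier S \<and> y \<in> carrier S \<and> Rop S x = Dop S y \<and> z = mult S x y"
  by (auto simp: category_of_def)

text \<open>
  Antisymmetry makes the maxima defining restriction, corestriction and meet unique, so the
  definite descriptions denote any element that has the defining property.
\<close>

lemma (in omega_structured_category) the_greatest:
  "is_greatest C A m \<Longrightarrow> (THE m. is_greatest C A m) = m"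
  unfolding is_greatest_def by (rule the_equality) (auto intro: cle_antisym)

context ordered_ehresmann_semigroup
begin

lemma omega_structured_category_of: "omega_structured_category (category_of S)"
proof
  show "\<D>\<^bsub>category_of S\<^esub> \<in> carrier (category_of S) \<rightarrow>\<^sub>E carrier (category_of S)"
    using D_closed by simp
  show "\<R>\<^bsub>category_of S\<^esub> \<in> carrier (category_of S) \<rightarrow>\<^sub>E carrier (category_of S)"
    using R_closed by simp
next
  fix x y z assume "x \<odot>\<^bsub>category_of S\<^esub> y = Some z"
  then have xyz: "x \<in> carrier S" "y \<in> carrier S" "\<R> x = \<D> y" "z = x \<cdot> y"
    by (auto simp: pcomp_category_of)
  show "\<D>\<^bsub>category_of S\<^esub> z = \<D>\<^bsub>category_of S\<^esub> x"
    using xyz by simp (metis D_mult R_right)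
  show "\<R>\<^bsub>category_of S\<^esub> z = \<R>\<^bsub>category_of S\<^esub> y"
    using xyz by simp (metis R_mult D_left)
next
  fix x y u z v w v'
  assume "x \<odot>\<^bsub>category_of S\<^esub> y = Some u" "u \<odot>\<^bsub>category_of S\<^esub> z = Some v"
    "y \<odot>\<^bsub>category_of S\<^esub> z = Some w" "x \<odot>\<^bsub>category_of S\<^esub> w = Some v'"
  then show "v = v'"
    by (auto simp: pcomp_category_of mult_assoc)
next
  fix x y
  show "(\<exists>z. x \<odot>\<^bsub>category_of S\<^esub> y = Some z) \<longleftrightarrow>
      x \<in> carrier (category_of S) \<and> y \<in> carrier (category_of S) \<and>
      \<R>\<^bsub>category_of S\<^esub> x = \<D>\<^bsub>category_of S\<^esub> y"
    by (simp add: pcomp_category_of)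
next
  fix a b c
  assume "a \<preceq>\<^bsub>category_of S\<^esub> b" "b \<preceq>\<^bsub>category_of S\<^esub> c"
  then show "a \<preceq>\<^bsub>category_of S\<^esub> c"
    using sle_trans by simp
next
  fix a b
  assume "a \<preceq>\<^bsub>category_of S\<^esub> b" "b \<preceq>\<^bsub>category_of S\<^esub> a"
  then show "a = b"
    using sle_antisym by simp
qed (simp_all add: pcomp_category_of D_left R_right D_R R_D sle_refl sle_carrier
      D_mono R_mono mult_mono)

lemma restriction_is_product:
  assumes "x \<in> carrier S" "e \<in> idents S" "e \<sqsubseteq> \<D> x"
  shows "is_greatest (category_of S) (res_set (category_of S) e x) (e \<cdot> x)"
    and "\<D> (e \<cdot> x) = e"
proof -
  show D: "\<D> (e \<cdot> x) = e"
    using assms by (simp add: D_ident_mult ident_absorb)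
  have "y \<sqsubseteq> e \<cdot> x" if "y \<sqsubseteq> x" "\<D> y \<sqsubseteq> e" for y
    using that mult_mono[OF that(2,1)] sle_carrier by (metis D_left)
  then show "is_greatest (category_of S) (res_set (category_of S) e x) (e \<cdot> x)"
    using assms D by (auto simp: is_greatest_def res_set_def sle_refl mult_ident_left)
qed

lemma corestriction_is_product:
  assumes "x \<in> carrier S" "e \<in> idents S" "e \<sqsubseteq> \<R> x"
  shows "is_greatest (category_of S) (cores_set (category_of S) x e) (x \<cdot> e)"
    and "\<R> (x \<cdot> e) = e"
proof -
  show R: "\<R> (x \<cdot> e) = e"
    using assms by (simp add: R_mult_ident ident_absorb)
  have "y \<sqsubseteq> x \<cdot> e" if "y \<sqsubseteq> x" "\<R> y \<sqsubseteq> e" for y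
    using that mult_mono[OF that(1,2)] sle_carrier by (metis R_right)
  then show "is_greatest (category_of S) (cores_set (category_of S) x e) (x \<cdot> e)"
    using assms R by (auto simp: is_greatest_def cores_set_def sle_refl mult_ident_right)
qed

lemma meet_is_product:
  assumes "e \<in> idents S" "f \<in> idents S"
  shows "is_greatest (category_of S) (lower_idents (category_of S) e f) (e \<cdot> f)"
  using assms
  by (auto simp: is_greatest_def lower_idents_def mult_ident_right mult_ident_left
        intro: ident_mult_greatest)

lemma res_category_of:
  "\<lbrakk>x \<in> carrier S; e \<in> idents S; e \<sqsubseteq> \<D> x\<rbrakk> \<Longrightarrow> res (category_of S) e x = e \<cdot> x"
  unfolding res_def
  by (rule omega_structured_category.the_greatest[OF omega_structured_category_of])
    (rule restriction_is_product)

lemma cores_category_of: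
  "\<lbrakk>x \<in> carrier S; e \<in> idents S; e \<sqsubseteq> \<R> x\<rbrakk> \<Longrightarrow> cores (category_of S) x e = x \<cdot> e"
  unfolding cores_def
  by (rule omega_structured_category.the_greatest[OF omega_structured_category_of])
    (rule corestriction_is_product)

lemma meet_category_of:
  "\<lbrakk>e \<in> idents S; f \<in> idents S\<rbrakk> \<Longrightarrow> meet (category_of S) e f = e \<cdot> f"
  unfolding meet_def
  by (rule omega_structured_category.the_greatest[OF omega_structured_category_of])
    (rule meet_is_product)

text \<open>
  The candidates are \<open>D(a)b\<close> and \<open>cR(a)\<close>, whose product \<open>D(a)bcR(a)\<close> lies above
  \<open>D(a)aR(a) = a\<close>. They need not match, so both are cut down to their overlap, which leaves the
  product unchanged. The identities \<open>D(b')\<close> and \<open>R(c')\<close> lie above those of \<open>a\<close> because the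
  product does, and below them by construction.
\<close>

lemma weak_factorisation:
  assumes b: "b \<in> carrier S" and c: "c \<in> carrier S" and a: "a \<sqsubseteq> b \<cdot> c"
  shows "\<exists>b' c'. b' \<sqsubseteq> b \<and> c' \<sqsubseteq> c \<and> \<D> a = \<D> b' \<and> \<R> a = \<R> c' \<and> \<R> b' = \<D> c' \<and> a \<sqsubseteq> b' \<cdot> c'"
proof -
  have aS: "a \<in> carrier S"
    using a sle_carrier by blast
  have Da: "\<D> a \<in> idents S" and Ra: "\<R> a \<in> idents S"
    using aS by simp_all
  define p where "p = \<D> a \<cdot> b"
  define q where "q = c \<cdot> \<R> a"
  define e where "e = \<R> p \<cdot> \<D> q"
  define b' where "b' = p \<cdot> e"
  define c' where "c' = e \<cdot> q"
  have p: "p \<in> carrier S" "p \<sqsubseteq> b" and q: "q \<in> carrier S" "q \<sqsubseteq> c"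
    using b c Da Ra by (simp_all add: p_def q_def mult_ident_left mult_ident_right)
  have e: "e \<in> idents S"
    using p(1) q(1) by (simp add: e_def)
  have b': "b' \<in> carrier S" "b' \<sqsubseteq> p" and c': "c' \<in> carrier S" "c' \<sqsubseteq> q"
    using p(1) q(1) e by (simp_all add: b'_def c'_def mult_ident_left mult_ident_right)
  have prod: "b' \<cdot> c' = p \<cdot> q" and match: "\<R> b' = \<D> c'"
    using mult_via_overlap[OF p(1) q(1)] by (simp_all add: b'_def c'_def e_def)
  have "\<D> a \<cdot> a \<cdot> \<R> a \<sqsubseteq> \<D> a \<cdot> (b \<cdot> c) \<cdot> \<R> a"
    by (intro mult_mono sle_refl a) (use aS in simp_all)
  then have le: "a \<sqsubseteq> b' \<cdot> c'"
    using aS b c by (simp add: prod p_def q_def D_left R_right mult_assoc)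
  have "\<D> (b' \<cdot> c') = \<D> b'" "\<R> (b' \<cdot> c') = \<R> c'"
    using b'(1) c'(1) match by (metis D_mult R_right, metis R_mult D_left)
  then have above: "\<D> a \<sqsubseteq> \<D> b'" "\<R> a \<sqsubseteq> \<R> c'"
    using D_mono[OF le] R_mono[OF le] by simp_all
  have "\<D> p \<sqsubseteq> \<D> a" "\<R> q \<sqsubseteq> \<R> a"
    using b c Da Ra
    by (simp_all add: p_def q_def D_ident_mult R_mult_ident mult_ident_left mult_ident_right)
  then have "\<D> b' \<sqsubseteq> \<D> a" "\<R> c' \<sqsubseteq> \<R> a"
    using D_mono[OF b'(2)] R_mono[OF c'(2)] sle_trans by blast+
  then have "\<D> a = \<D> b'" "\<R> a = \<R> c'"
    using above sle_antisym by blast+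
  moreover have "b' \<sqsubseteq> b" "c' \<sqsubseteq> c"
    using b'(2) c'(2) p(2) q(2) sle_trans by blast+
  ultimately show ?thesis
    using match le by blast
qed

theorem ehresmann_ordered_category_of: "ehresmann_ordered_category (category_of S)"
proof -
  interpret C: omega_structured_category "category_of S"
    by (rule omega_structured_category_of)
  show ?thesis
  proof
    fix x e
    assume "x \<in> carrier (category_of S)" "e \<in> idents (category_of S)"
      "e \<preceq>\<^bsub>category_of S\<^esub> \<D>\<^bsub>category_of S\<^esub> x"
    then show "\<exists>m. is_greatest (category_of S) (res_set (category_of S) e x) m \<and>
        \<D>\<^bsub>category_of S\<^esub> m = e"
      using restriction_is_product[of x e] by (intro exI[of _ "e \<cdot> x"]) simp
  next
    fix x e
    assume "x \<in> carrier (category_of S)" "e \<in> idents (category_of S)"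
      "e \<preceq>\<^bsub>category_of S\<^esub> \<R>\<^bsub>category_of S\<^esub> x"
    then show "\<exists>m. is_greatest (category_of S) (cores_set (category_of S) x e) m \<and>
        \<R>\<^bsub>category_of S\<^esub> m = e"
      using corestriction_is_product[of x e] by (intro exI[of _ "x \<cdot> e"]) simp
  next
    fix a b c d
    assume "b \<odot>\<^bsub>category_of S\<^esub> c = Some d" "a \<preceq>\<^bsub>category_of S\<^esub> d"
    then show "\<exists>b' c' d'. b' \<preceq>\<^bsub>category_of S\<^esub> b \<and> c' \<preceq>\<^bsub>category_of S\<^esub> c \<and>
        \<D>\<^bsub>category_of S\<^esub> a = \<D>\<^bsub>category_of S\<^esub> b' \<and> \<R>\<^bsub>category_of S\<^esub> a = \<R>\<^bsub>category_of S\<^esub> c' \<and>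
        b' \<odot>\<^bsub>category_of S\<^esub> c' = Some d' \<and> a \<preceq>\<^bsub>category_of S\<^esub> d'"
      using weak_factorisation[of b c a] sle_carrier
      by (fastforce simp: pcomp_category_of)
  qed (auto intro: idents_down meet_is_product)
qed

end

lemma OC4_category_of: "OS4 S \<Longrightarrow> OC4 (category_of S)"
  by (simp add: OS4_def OC4_def)

text \<open>
  A factorisation \<open>a = st\<close> in the semigroup becomes one in the category once \<open>s\<close> and \<open>t\<close> are cut
  down to their overlap; the cut factors are still below \<open>b\<close> and \<open>c\<close>.
\<close>

lemma OC7_category_of:
  assumes "ordered_ehresmann_semigroup S" "OS7 S"
  shows "OC7 (category_of S)"
  unfolding OC7_def
proof (intro allI impI, elim conjE)
  interpret ordered_ehresmann_semigroup S by fact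
  fix a b c d
  assume "b \<odot>\<^bsub>category_of S\<^esub> c = Some d" "a \<preceq>\<^bsub>category_of S\<^esub> d"
  then have "b \<in> carrier S" "c \<in> carrier S" "a \<sqsubseteq>\<^bsub>S\<^esub> b \<cdot>\<^bsub>S\<^esub> c"
    by (auto simp: pcomp_category_of)
  then obtain s t where st: "s \<sqsubseteq>\<^bsub>S\<^esub> b" "t \<sqsubseteq>\<^bsub>S\<^esub> c" "a = s \<cdot>\<^bsub>S\<^esub> t"
    using assms(2) sle_carrier unfolding OS7_def by blast
  have sS: "s \<in> carrier S" and tS: "t \<in> carrier S"
    using st sle_carrier by blast+
  let ?e = "\<R>\<^bsub>S\<^esub> s \<cdot>\<^bsub>S\<^esub> \<D>\<^bsub>S\<^esub> t"
  have e: "?e \<in> idents S"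
    using sS tS by simp
  have "s \<cdot>\<^bsub>S\<^esub> ?e \<sqsubseteq>\<^bsub>S\<^esub> b" "?e \<cdot>\<^bsub>S\<^esub> t \<sqsubseteq>\<^bsub>S\<^esub> c"
    using mult_ident_right[OF sS e] mult_ident_left[OF tS e] st sle_trans by blast+
  moreover have "(s \<cdot>\<^bsub>S\<^esub> ?e) \<odot>\<^bsub>category_of S\<^esub> (?e \<cdot>\<^bsub>S\<^esub> t) = Some a"
    using mult_via_overlap[OF sS tS] sS tS st(3) by (simp add: pcomp_category_of)
  ultimately show "\<exists>b' c'. b' \<preceq>\<^bsub>category_of S\<^esub> b \<and> c' \<preceq>\<^bsub>category_of S\<^esub> c \<and>
      b' \<odot>\<^bsub>category_of S\<^esub> c' = Some a"
    by auto
qed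


section \<open>The semigroup of an ordered category\<close>

text \<open>
  The product is undefined outside the carrier, since otherwise \<open>semigroup_of\<close> would invert
  \<open>category_of\<close> only up to values that carry no meaning. The composite under \<open>the\<close> always exists
  when both meet and restrictions do, as \<open>R(x|e) = e = D(e|y)\<close>.
\<close>

definition semigroup_of :: "('a, 'b) ordered_cat_scheme \<Rightarrow> 'a ordered_sgp" where
  "semigroup_of C =
     \<lparr>carrier = carrier C, Dop = Dop C, Rop = Rop C,
      mult = (\<lambda>x y. if x \<in> carrier C \<and> y \<in> carrier C
        then let e = meet C (Rop C x) (Dop C y) in the (pcomp C (cores C x e) (res C e y))
        else undefined),
      sle = cle C\<rparr>"

lemma semigroup_of_sel [simp]:
  "carrier (semigroup_of C) = carrier C"
  "Dop (semigroup_of C) = Dop C"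
  "Rop (semigroup_of C) = Rop C"
  "sle (semigroup_of C) = cle C"
  "idents (semigroup_of C) = idents C"
  by (simp_all add: semigroup_of_def idents_def)

context ehresmann_ordered_category
begin

lemma D_in [simp]: "s \<in> carrier C \<Longrightarrow> \<D> s \<in> carrier C"
  using D_closed by (rule PiE_mem)

lemma R_in [simp]: "s \<in> carrier C \<Longrightarrow> \<R> s \<in> carrier C"
  using R_closed by (rule PiE_mem)

lemma ident_in [simp]: "e \<in> idents C \<Longrightarrow> e \<in> carrier C"
  by (auto simp: idents_def)

lemma R_ident [simp]: "e \<in> idents C \<Longrightarrow> \<R> e = e"
  by (auto simp: idents_def R_D)

lemma D_ident [simp]: "e \<in> idents C \<Longrightarrow> \<D> e = e"
  by (metis D_R R_ident ident_in)

lemma D_idents [simp]: "s \<in> carrier C \<Longrightarrow> \<D> s \<in> idents C"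
  unfolding idents_def by (rule imageI)

lemma R_idents [simp]: "s \<in> carrier C \<Longrightarrow> \<R> s \<in> idents C"
  by (metis D_R D_idents R_in)

lemma meet_greatest:
  assumes "e \<in> idents C" "f \<in> idents C"
  shows "is_greatest C (lower_idents C e f) (meet C e f)"
  using idents_meet[OF assms] the_greatest unfolding meet_def by metis

lemma meet_ident [simp]: "\<lbrakk>e \<in> idents C; f \<in> idents C\<rbrakk> \<Longrightarrow> meet C e f \<in> idents C"
  using meet_greatest by (simp add: is_greatest_def lower_idents_def)

lemma meet_below:
  assumes "e \<in> idents C" "f \<in> idents C"
  shows "meet C e f \<preceq> e" "meet C e f \<preceq> f"
  using meet_greatest[OF assms] by (simp_all add: is_greatest_def lower_idents_def)

lemma meet_max:
  "\<lbrakk>e \<in> idents C; f \<in> idents C; g \<in> idents C; g \<preceq> e; g \<preceq> f\<rbrakk> \<Longrightarrow> g \<preceq> meet C e f"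
  using meet_greatest by (simp add: is_greatest_def lower_idents_def)

lemma meet_commute: "meet C e f = meet C f e"
  by (simp add: meet_def lower_idents_def conj_commute)

lemma meet_idem [simp]: "e \<in> idents C \<Longrightarrow> meet C e e = e"
  by (intro cle_antisym meet_below meet_max cle_refl) auto

lemma res_greatest:
  assumes "x \<in> carrier C" "e \<in> idents C" "e \<preceq> \<D> x"
  shows "is_greatest C (res_set C e x) (res C e x)" and "\<D> (res C e x) = e"
  using OC6_left[OF assms] the_greatest unfolding res_def by metis+

lemma cores_greatest:
  assumes "x \<in> carrier C" "e \<in> idents C" "e \<preceq> \<R> x"
  shows "is_greatest C (cores_set C x e) (cores C x e)" and "\<R> (cores C x e) = e"
  using OC6_right[OF assms] the_greatest unfolding cores_def by metis+

lemma sgp_mult_composite: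
  assumes "x \<in> carrier C" "y \<in> carrier C"
  defines "e \<equiv> meet C (\<R> x) (\<D> y)"
  shows "cores C x e \<preceq> x" "res C e y \<preceq> y" "\<R> (cores C x e) = e" "\<D> (res C e y) = e"
    and "cores C x e \<odot> res C e y = Some (x \<cdot>\<^bsub>semigroup_of C\<^esub> y)"
proof -
  have e: "e \<in> idents C" "e \<preceq> \<R> x" "e \<preceq> \<D> y"
    using assms meet_below by simp_all
  show le: "cores C x e \<preceq> x" "res C e y \<preceq> y"
    using res_greatest(1)[OF assms(2) e(1,3)] cores_greatest(1)[OF assms(1) e(1,2)]
    by (simp_all add: is_greatest_def res_set_def cores_set_def)
  show match: "\<R> (cores C x e) = e" "\<D> (res C e y) = e"
    using res_greatest(2)[OF assms(2) e(1,3)] cores_greatest(2)[OF assms(1) e(1,2)]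
    by simp_all
  have "\<exists>z. cores C x e \<odot> res C e y = Some z"
    using le match cle_carrier by (auto simp: comp_defined)
  then show "cores C x e \<odot> res C e y = Some (x \<cdot>\<^bsub>semigroup_of C\<^esub> y)"
    using assms(1,2) by (auto simp: semigroup_of_def e_def Let_def)
qed

text \<open>
  The next two lemmas characterise the product as a maximum of composites, so that
  monotonicity and associativity can be proved without mentioning restrictions.
\<close>

lemma sgp_mult_attained:
  assumes "s \<in> carrier C" "t \<in> carrier C"
  obtains x y where "x \<preceq> s" "y \<preceq> t" "x \<odot> y = Some (s \<cdot>\<^bsub>semigroup_of C\<^esub> t)"
  using sgp_mult_composite[OF assms] by blast

text \<open>
  If \<open>x \<circ> y\<close> exists then \<open>R(x) = D(y)\<close> lies below both \<open>R(s)\<close> and \<open>D(t)\<close>, hence below their meet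
  \<open>e\<close>. So \<open>x\<close> and \<open>y\<close> compete in the maxima that define \<open>s|e\<close> and \<open>e|t\<close>.
\<close>

lemma sgp_mult_upper_bound:
  assumes x: "x \<preceq> s" and y: "y \<preceq> t" and xy: "x \<odot> y = Some z"
  shows "z \<preceq> s \<cdot>\<^bsub>semigroup_of C\<^esub> t"
proof -
  have S: "x \<in> carrier C" "y \<in> carrier C" "s \<in> carrier C" "t \<in> carrier C"
    using x y cle_carrier by blast+
  let ?e = "meet C (\<R> s) (\<D> t)"
  have e: "?e \<in> idents C" "?e \<preceq> \<R> s" "?e \<preceq> \<D> t"
    using S meet_below by simp_all
  have match: "\<R> x = \<D> y"
    using xy comp_defined by blast
  have Rx: "\<R> x \<preceq> ?e"
    using meet_max[of "\<R> s" "\<D> t" "\<R> x"] S R_mono[OF x] D_mono[OF y] match by simp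
  have "x \<preceq> cores C s ?e"
    using cores_greatest(1)[OF S(3) e(1,2)] x Rx
    by (simp add: is_greatest_def cores_set_def)
  moreover have "y \<preceq> res C ?e t"
    using res_greatest(1)[OF S(4) e(1,3)] y Rx match
    by (simp add: is_greatest_def res_set_def)
  ultimately show ?thesis
    using comp_mono xy sgp_mult_composite(5)[OF S(3,4)] by blast
qed

lemma sgp_mult_closed [simp]:
  "\<lbrakk>s \<in> carrier C; t \<in> carrier C\<rbrakk> \<Longrightarrow> s \<cdot>\<^bsub>semigroup_of C\<^esub> t \<in> carrier C"
  using sgp_mult_composite(5) comp_closed by blast

lemma sgp_mult_mono:
  assumes "a \<preceq> b" "c \<preceq> d"
  shows "a \<cdot>\<^bsub>semigroup_of C\<^esub> c \<preceq> b \<cdot>\<^bsub>semigroup_of C\<^esub> d"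
proof -
  obtain x y where "x \<preceq> a" "y \<preceq> c" "x \<odot> y = Some (a \<cdot>\<^bsub>semigroup_of C\<^esub> c)"
    using sgp_mult_attained assms cle_carrier by metis
  then show ?thesis
    using sgp_mult_upper_bound assms cle_trans by blast
qed

lemma sgp_mult_extends_comp:
  assumes "x \<odot> y = Some z"
  shows "x \<cdot>\<^bsub>semigroup_of C\<^esub> y = z"
proof -
  have S: "x \<in> carrier C" "y \<in> carrier C" "\<R> x = \<D> y"
    using assms comp_defined by blast+
  obtain a b where "a \<preceq> x" "b \<preceq> y" "a \<odot> b = Some (x \<cdot>\<^bsub>semigroup_of C\<^esub> y)"
    using sgp_mult_attained S by metis
  then have "x \<cdot>\<^bsub>semigroup_of C\<^esub> y \<preceq> z"
    using comp_mono assms by blast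
  moreover have "z \<preceq> x \<cdot>\<^bsub>semigroup_of C\<^esub> y"
    using sgp_mult_upper_bound assms S cle_refl by blast
  ultimately show ?thesis
    by (rule cle_antisym)
qed

lemma comp_ident:
  assumes "x \<odot> y = Some z"
  shows "y \<in> idents C \<Longrightarrow> z = x" and "x \<in> idents C \<Longrightarrow> z = y"
proof -
  have S: "x \<in> carrier C" "y \<in> carrier C" "\<R> x = \<D> y"
    using assms comp_defined by blast+
  show "y \<in> idents C \<Longrightarrow> z = x"
    using S assms R_right[OF S(1)] by simp
  show "x \<in> idents C \<Longrightarrow> z = y"
    using S assms D_left[OF S(2)] by simp
qed

lemma sgp_mult_ident_right:
  assumes "a \<in> carrier C" "e \<in> idents C"
  shows "a \<cdot>\<^bsub>semigroup_of C\<^esub> e \<preceq> a"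
proof -
  obtain x y where xy: "x \<preceq> a" "y \<preceq> e" "x \<odot> y = Some (a \<cdot>\<^bsub>semigroup_of C\<^esub> e)"
    using sgp_mult_attained[of a e] assms by auto
  then have "y \<in> idents C"
    using OCI assms cle_carrier by blast
  then show ?thesis
    using comp_ident(1)[OF xy(3)] xy(1) by simp
qed

lemma sgp_mult_ident_left:
  assumes "a \<in> carrier C" "e \<in> idents C"
  shows "e \<cdot>\<^bsub>semigroup_of C\<^esub> a \<preceq> a"
proof -
  obtain x y where xy: "x \<preceq> e" "y \<preceq> a" "x \<odot> y = Some (e \<cdot>\<^bsub>semigroup_of C\<^esub> a)"
    using sgp_mult_attained[of e a] assms by auto
  then have "x \<in> idents C"
    using OCI assms cle_carrier by blast
  then show ?thesis
    using comp_ident(2)[OF xy(3)] xy(2) by simp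
qed

lemma sgp_mult_idents:
  assumes "e \<in> idents C" "f \<in> idents C"
  shows "e \<cdot>\<^bsub>semigroup_of C\<^esub> f = meet C e f"
proof (rule cle_antisym)
  let ?p = "e \<cdot>\<^bsub>semigroup_of C\<^esub> f" and ?m = "meet C e f"
  have "?p \<preceq> e" "?p \<preceq> f"
    using sgp_mult_ident_right sgp_mult_ident_left assms by simp_all
  moreover from this have "?p \<in> idents C"
    using OCI assms cle_carrier by blast
  ultimately show "?p \<preceq> ?m"
    using meet_max assms by blast
  have "?m \<odot> ?m = Some ?m"
    using D_left[of ?m] assms by simp
  then show "?m \<preceq> ?p"
    using sgp_mult_upper_bound meet_below[OF assms] by blast
qed

text \<open>
  Both sides are the domain of the same corestriction \<open>s|e\<close>, because \<open>e = R(s) \<and> D(t)\<close> depends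
  on \<open>t\<close> through \<open>D(t)\<close> only.
\<close>

lemma sgp_D_mult:
  assumes "s \<in> carrier C" "t \<in> carrier C"
  shows "\<D> (s \<cdot>\<^bsub>semigroup_of C\<^esub> t) = \<D> (s \<cdot>\<^bsub>semigroup_of C\<^esub> \<D> t)"
  using D_comp[OF sgp_mult_composite(5)[OF assms]]
    D_comp[OF sgp_mult_composite(5)[OF assms(1), of "\<D> t"]]
    assms by simp

lemma sgp_R_mult:
  assumes "s \<in> carrier C" "t \<in> carrier C"
  shows "\<R> (s \<cdot>\<^bsub>semigroup_of C\<^esub> t) = \<R> (\<R> s \<cdot>\<^bsub>semigroup_of C\<^esub> t)"
  using R_comp[OF sgp_mult_composite(5)[OF assms]]
    R_comp[OF sgp_mult_composite(5)[of "\<R> s" t]]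
    assms by simp

end

text \<open>
  (OC7') places \<open>a\<close> below a composite with the domain and range of \<open>a\<close>, and (OC4) forces the two
  to coincide.
\<close>

lemma OC7_if_OC4:
  assumes "ehresmann_ordered_category C" "OC4 C"
  shows "OC7 C"
  unfolding OC7_def
proof (intro allI impI, elim conjE)
  interpret ehresmann_ordered_category C by fact
  fix a b c d
  assume "b \<odot>\<^bsub>C\<^esub> c = Some d" "a \<preceq>\<^bsub>C\<^esub> d"
  then obtain b' c' d' where *: "b' \<preceq>\<^bsub>C\<^esub> b" "c' \<preceq>\<^bsub>C\<^esub> c" "\<D>\<^bsub>C\<^esub> a = \<D>\<^bsub>C\<^esub> b'" "\<R>\<^bsub>C\<^esub> a = \<R>\<^bsub>C\<^esub> c'"
    "b' \<odot>\<^bsub>C\<^esub> c' = Some d'" "a \<preceq>\<^bsub>C\<^esub> d'"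
    using OC7' by blast
  then have "a = d'"
    using assms(2) D_comp[OF *(5)] R_comp[OF *(5)] cle_carrier[OF *(6)]
    unfolding OC4_def by simp
  then show "\<exists>b' c'. b' \<preceq>\<^bsub>C\<^esub> b \<and> c' \<preceq>\<^bsub>C\<^esub> c \<and> b' \<odot>\<^bsub>C\<^esub> c' = Some a"
    using * by blast
qed

locale factorising_category = ehresmann_ordered_category C
  for C :: "'a ordered_cat" (structure) +
  assumes factorising: "OC7 C"
begin

text \<open>
  Both bracketings are the maximum of all triple composites \<open>x \<circ> y \<circ> z\<close> with \<open>x \<le> s\<close>,
  \<open>y \<le> t\<close>, \<open>z \<le> u\<close>: (OC7) splits the factor that lies below the inner product.
\<close>

lemma sgp_mult_assoc:
  assumes s: "s \<in> carrier C" and t: "t \<in> carrier C" and u: "u \<in> carrier C"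
  shows "(s \<cdot>\<^bsub>semigroup_of C\<^esub> t) \<cdot>\<^bsub>semigroup_of C\<^esub> u = s \<cdot>\<^bsub>semigroup_of C\<^esub> (t \<cdot>\<^bsub>semigroup_of C\<^esub> u)"
    (is "?l = ?r")
proof (rule cle_antisym)
  obtain a z where az: "a \<preceq> s \<cdot>\<^bsub>semigroup_of C\<^esub> t" "z \<preceq> u" "a \<odot> z = Some ?l"
    using sgp_mult_attained[of "s \<cdot>\<^bsub>semigroup_of C\<^esub> t" u] s t u by auto
  obtain x y where xy: "x \<preceq> s" "y \<preceq> t" "x \<odot> y = Some (s \<cdot>\<^bsub>semigroup_of C\<^esub> t)"
    using sgp_mult_attained[OF s t] .
  obtain x' y' where xy': "x' \<preceq> x" "y' \<preceq> y" "x' \<odot> y' = Some a"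
    using factorising xy(3) az(1) unfolding OC7_def by blast
  have c: "x' \<in> carrier C" "y' \<in> carrier C" "z \<in> carrier C" "a \<in> carrier C"
    using xy' az cle_carrier by blast+
  have "\<R> y' = \<D> z"
    using R_comp[OF xy'(3)] az(3) comp_defined by metis
  then obtain w where w: "y' \<odot> z = Some w"
    using comp_defined c by metis
  have "\<R> x' = \<D> w"
    using D_comp[OF w] xy'(3) comp_defined by metis
  then obtain v where v: "x' \<odot> w = Some v"
    using comp_defined c comp_closed[OF w] by metis
  have "?l = v"
    by (rule comp_assoc[OF xy'(3) az(3) w v])
  moreover have "w \<preceq> t \<cdot>\<^bsub>semigroup_of C\<^esub> u"
    using sgp_mult_upper_bound[OF _ az(2) w] xy'(2) xy(2) cle_trans by blast
  then have "v \<preceq> ?r"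
    using sgp_mult_upper_bound[OF _ _ v] xy'(1) xy(1) cle_trans by blast
  ultimately show "?l \<preceq> ?r"
    by simp
next
  obtain x a where xa: "x \<preceq> s" "a \<preceq> t \<cdot>\<^bsub>semigroup_of C\<^esub> u" "x \<odot> a = Some ?r"
    using sgp_mult_attained[of s "t \<cdot>\<^bsub>semigroup_of C\<^esub> u"] s t u by auto
  obtain y z where yz: "y \<preceq> t" "z \<preceq> u" "y \<odot> z = Some (t \<cdot>\<^bsub>semigroup_of C\<^esub> u)"
    using sgp_mult_attained[OF t u] .
  obtain y' z' where yz': "y' \<preceq> y" "z' \<preceq> z" "y' \<odot> z' = Some a"
    using factorising yz(3) xa(2) unfolding OC7_def by blast
  have c: "x \<in> carrier C" "y' \<in> carrier C" "z' \<in> carrier C" "a \<in> carrier C"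
    using yz' xa cle_carrier by blast+
  have "\<R> x = \<D> y'"
    using D_comp[OF yz'(3)] xa(3) comp_defined by metis
  then obtain w where w: "x \<odot> y' = Some w"
    using comp_defined c by metis
  have "\<R> w = \<D> z'"
    using R_comp[OF w] yz'(3) comp_defined by metis
  then obtain v where v: "w \<odot> z' = Some v"
    using comp_defined c comp_closed[OF w] by metis
  have "v = ?r"
    by (rule comp_assoc[OF w v yz'(3) xa(3)])
  moreover have "w \<preceq> s \<cdot>\<^bsub>semigroup_of C\<^esub> t"
    using sgp_mult_upper_bound[OF xa(1) _ w] yz'(1) yz(1) cle_trans by blast
  then have "v \<preceq> ?l"
    using sgp_mult_upper_bound[OF _ _ v] yz'(2) yz(2) cle_trans by blast
  ultimately show "?r \<preceq> ?l"
    by simp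
qed

theorem ordered_ehresmann_semigroup_of: "ordered_ehresmann_semigroup (semigroup_of C)"
proof
  show "\<D>\<^bsub>semigroup_of C\<^esub> \<in> carrier (semigroup_of C) \<rightarrow>\<^sub>E carrier (semigroup_of C)"
    using D_closed by simp
  show "\<R>\<^bsub>semigroup_of C\<^esub> \<in> carrier (semigroup_of C) \<rightarrow>\<^sub>E carrier (semigroup_of C)"
    using R_closed by simp
  have "mult (semigroup_of C) x y = undefined" if "\<not> (x \<in> carrier C \<and> y \<in> carrier C)" for x y
    using that by (auto simp: semigroup_of_def)
  then show "case_prod (mult (semigroup_of C)) \<in>
      carrier (semigroup_of C) \<times> carrier (semigroup_of C) \<rightarrow>\<^sub>E carrier (semigroup_of C)"
    by (auto simp: PiE_def extensional_def)
next
  fix s t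
  assume "s \<in> carrier (semigroup_of C)" "t \<in> carrier (semigroup_of C)"
  then show "\<D>\<^bsub>semigroup_of C\<^esub> (s \<cdot>\<^bsub>semigroup_of C\<^esub> t) =
      \<D>\<^bsub>semigroup_of C\<^esub> (s \<cdot>\<^bsub>semigroup_of C\<^esub> \<D>\<^bsub>semigroup_of C\<^esub> t)"
    and "\<R>\<^bsub>semigroup_of C\<^esub> (s \<cdot>\<^bsub>semigroup_of C\<^esub> t) =
      \<R>\<^bsub>semigroup_of C\<^esub> (\<R>\<^bsub>semigroup_of C\<^esub> s \<cdot>\<^bsub>semigroup_of C\<^esub> t)"
    and "\<D>\<^bsub>semigroup_of C\<^esub> s \<cdot>\<^bsub>semigroup_of C\<^esub> \<D>\<^bsub>semigroup_of C\<^esub> t =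
      \<D>\<^bsub>semigroup_of C\<^esub> t \<cdot>\<^bsub>semigroup_of C\<^esub> \<D>\<^bsub>semigroup_of C\<^esub> s"
    using sgp_D_mult[of s t] sgp_R_mult[of s t] meet_commute[of "\<D> s"]
    by (simp_all add: sgp_mult_idents)
next
  fix a b c
  assume "a \<sqsubseteq>\<^bsub>semigroup_of C\<^esub> b" "b \<sqsubseteq>\<^bsub>semigroup_of C\<^esub> c"
  then show "a \<sqsubseteq>\<^bsub>semigroup_of C\<^esub> c"
    using cle_trans by simp
next
  fix a b
  assume "a \<sqsubseteq>\<^bsub>semigroup_of C\<^esub> b" "b \<sqsubseteq>\<^bsub>semigroup_of C\<^esub> a"
  then show "a = b"
    using cle_antisym by simp
next
  fix a e
  assume "a \<in> carrier (semigroup_of C)" "e \<in> idents (semigroup_of C)"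
    "a \<sqsubseteq>\<^bsub>semigroup_of C\<^esub> e"
  then show "a \<in> idents (semigroup_of C)"
    using OCI[of a e] by simp
qed (simp_all add: sgp_mult_assoc sgp_mult_extends_comp D_left R_right D_R R_D cle_refl cle_carrier
      sgp_mult_idents sgp_mult_mono sgp_mult_ident_right sgp_mult_ident_left D_mono R_mono)

end

lemma OS4_semigroup_of: "OC4 C \<Longrightarrow> OS4 (semigroup_of C)"
  by (simp add: OS4_def OC4_def)

lemma OS7_semigroup_of:
  assumes "ehresmann_ordered_category C" "OC7 C"
  shows "OS7 (semigroup_of C)"
  unfolding OS7_def
proof (intro ballI impI)
  interpret ehresmann_ordered_category C by fact
  fix u s t
  assume "s \<in> carrier (semigroup_of C)" "t \<in> carrier (semigroup_of C)"
    and u: "u \<sqsubseteq>\<^bsub>semigroup_of C\<^esub> s \<cdot>\<^bsub>semigroup_of C\<^esub> t"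
  then obtain x y where xy: "x \<preceq>\<^bsub>C\<^esub> s" "y \<preceq>\<^bsub>C\<^esub> t" "x \<odot>\<^bsub>C\<^esub> y = Some (s \<cdot>\<^bsub>semigroup_of C\<^esub> t)"
    using sgp_mult_attained[of s t] unfolding semigroup_of_sel by metis
  then obtain x' y' where "x' \<preceq>\<^bsub>C\<^esub> x" "y' \<preceq>\<^bsub>C\<^esub> y" "x' \<odot>\<^bsub>C\<^esub> y' = Some u"
    using assms(2) u unfolding OC7_def by (metis semigroup_of_sel(4))
  then show "\<exists>s' t'. s' \<sqsubseteq>\<^bsub>semigroup_of C\<^esub> s \<and> t' \<sqsubseteq>\<^bsub>semigroup_of C\<^esub> t \<and> u = s' \<cdot>\<^bsub>semigroup_of C\<^esub> t'"
    using xy cle_trans sgp_mult_extends_comp by (metis semigroup_of_sel(4))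
qed


section \<open>The two constructions are mutually inverse\<close>

lemma category_of_semigroup_of:
  fixes C :: "'a ordered_cat"
  assumes "ehresmann_ordered_category C"
  shows "category_of (semigroup_of C) = C"
proof -
  interpret ehresmann_ordered_category C by fact
  have "pcomp (category_of (semigroup_of C)) x y = pcomp C x y" for x y
  proof (cases "pcomp C x y")
    case None
    then have "\<not> (x \<in> carrier C \<and> y \<in> carrier C \<and> Rop C x = Dop C y)"
      using comp_defined[of x y] by simp
    then show ?thesis
      using None by (auto simp: category_of_def)
  next
    case (Some z)
    then have "x \<in> carrier C \<and> y \<in> carrier C \<and> Rop C x = Dop C y"
      using comp_defined by blast
    then show ?thesis
      using Some sgp_mult_extends_comp[OF Some] by (simp add: pcomp_category_of)
  qed
  then show ?thesis
    by (intro ordered_cat.equality) (auto intro!: ext)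
qed

lemma semigroup_of_category_of:
  fixes S :: "'a ordered_sgp"
  assumes "ordered_ehresmann_semigroup S"
  shows "semigroup_of (category_of S) = S"
proof -
  interpret ordered_ehresmann_semigroup S by fact
  have "mult (semigroup_of (category_of S)) x y = mult S x y" for x y
  proof (cases "x \<in> carrier S \<and> y \<in> carrier S")
    case True
    let ?e = "\<R>\<^bsub>S\<^esub> x \<cdot>\<^bsub>S\<^esub> \<D>\<^bsub>S\<^esub> y"
    have e: "?e \<in> idents S" "?e \<sqsubseteq>\<^bsub>S\<^esub> \<R>\<^bsub>S\<^esub> x" "?e \<sqsubseteq>\<^bsub>S\<^esub> \<D>\<^bsub>S\<^esub> y"
      using True by (simp_all add: mult_ident_right mult_ident_left)
    have "(x \<cdot>\<^bsub>S\<^esub> ?e) \<odot>\<^bsub>category_of S\<^esub> (?e \<cdot>\<^bsub>S\<^esub> y) = Some (x \<cdot>\<^bsub>S\<^esub> y)"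
      using True mult_via_overlap[of x y] by (simp add: pcomp_category_of)
    then show ?thesis
      using True e
      by (simp add: semigroup_of_def meet_category_of cores_category_of res_category_of)
  next
    case False
    then show ?thesis
      using mult_closed
      by (auto simp: semigroup_of_def PiE_def extensional_def)
  qed
  then show ?thesis
    by (intro ordered_sgp.equality) (auto intro!: ext)
qed

text \<open>
  A semigroup homomorphism preserves meets and restrictions because they are products.
  Conversely, \<open>st\<close> is the composite of \<open>s|e\<close> and \<open>e|t\<close> for the meet \<open>e\<close> of \<open>R(s)\<close> and \<open>D(t)\<close>, and a morphism of
  categories preserves each ingredient.
\<close>

lemma OES_hom_iff_EOC_hom:
  assumes "ordered_ehresmann_semigroup S" "ordered_ehresmann_semigroup T"
  shows "OES_hom S T F \<longleftrightarrow> EOC_hom (category_of S) (category_of T) F"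
proof
  interpret S: ordered_ehresmann_semigroup S by fact
  interpret T: ordered_ehresmann_semigroup T by fact
  assume h: "OES_hom S T F"
  then have in_T: "s \<in> carrier S \<Longrightarrow> F s \<in> carrier T" for s
    by (auto simp: OES_hom_def)
  have D: "s \<in> carrier S \<Longrightarrow> F (\<D>\<^bsub>S\<^esub> s) = \<D>\<^bsub>T\<^esub> (F s)"
    and R: "s \<in> carrier S \<Longrightarrow> F (\<R>\<^bsub>S\<^esub> s) = \<R>\<^bsub>T\<^esub> (F s)"
    and mono: "s \<sqsubseteq>\<^bsub>S\<^esub> t \<Longrightarrow> F s \<sqsubseteq>\<^bsub>T\<^esub> F t"
    and mult: "\<lbrakk>s \<in> carrier S; t \<in> carrier S\<rbrakk> \<Longrightarrow> F (s \<cdot>\<^bsub>S\<^esub> t) = F s \<cdot>\<^bsub>T\<^esub> F t" for s t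
    using h by (auto simp: OES_hom_def)
  have ident: "F e \<in> idents T" if "e \<in> idents S" for e
    using that D in_T by (metis S.D_ident S.ident_in T.D_idents)
  have "is_functor (category_of S) (category_of T) F"
    using h by (auto simp: OES_hom_def is_functor_def pcomp_category_of) metis
  moreover have "F (res (category_of S) e s) = res (category_of T) (F e) (F s)"
    if "s \<in> carrier S" "e \<in> idents S" "e \<sqsubseteq>\<^bsub>S\<^esub> \<D>\<^bsub>S\<^esub> s" for s e
    using that mono[OF that(3)] in_T ident D mult
    by (simp add: S.res_category_of T.res_category_of)
  moreover have "F (cores (category_of S) s e) = cores (category_of T) (F s) (F e)"
    if "s \<in> carrier S" "e \<in> idents S" "e \<sqsubseteq>\<^bsub>S\<^esub> \<R>\<^bsub>S\<^esub> s" for s e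
    using that mono[OF that(3)] in_T ident R mult
    by (simp add: S.cores_category_of T.cores_category_of)
  ultimately show "EOC_hom (category_of S) (category_of T) F"
    using mono ident mult
    by (auto simp: EOC_hom_def S.meet_category_of T.meet_category_of)
next
  interpret S: ordered_ehresmann_semigroup S by fact
  interpret T: ordered_ehresmann_semigroup T by fact
  assume h: "EOC_hom (category_of S) (category_of T) F"
  then have fct: "is_functor (category_of S) (category_of T) F"
    by (simp add: EOC_hom_def)
  then have in_T: "s \<in> carrier S \<Longrightarrow> F s \<in> carrier T" for s
    by (auto simp: is_functor_def)
  have D: "s \<in> carrier S \<Longrightarrow> F (\<D>\<^bsub>S\<^esub> s) = \<D>\<^bsub>T\<^esub> (F s)"
    and R: "s \<in> carrier S \<Longrightarrow> F (\<R>\<^bsub>S\<^esub> s) = \<R>\<^bsub>T\<^esub> (F s)"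
    and mono: "s \<sqsubseteq>\<^bsub>S\<^esub> t \<Longrightarrow> F s \<sqsubseteq>\<^bsub>T\<^esub> F t" for s t
    using h by (auto simp: EOC_hom_def is_functor_def)
  have "F (s \<cdot>\<^bsub>S\<^esub> t) = F s \<cdot>\<^bsub>T\<^esub> F t" if s: "s \<in> carrier S" and t: "t \<in> carrier S" for s t
  proof -
    let ?e = "\<R>\<^bsub>S\<^esub> s \<cdot>\<^bsub>S\<^esub> \<D>\<^bsub>S\<^esub> t"
    let ?f = "\<R>\<^bsub>T\<^esub> (F s) \<cdot>\<^bsub>T\<^esub> \<D>\<^bsub>T\<^esub> (F t)"
    have e: "?e \<in> idents S" "?e \<sqsubseteq>\<^bsub>S\<^esub> \<R>\<^bsub>S\<^esub> s" "?e \<sqsubseteq>\<^bsub>S\<^esub> \<D>\<^bsub>S\<^esub> t"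
      using s t by (simp_all add: S.mult_ident_right S.mult_ident_left)
    have f: "?f \<in> idents T" "?f \<sqsubseteq>\<^bsub>T\<^esub> \<R>\<^bsub>T\<^esub> (F s)" "?f \<sqsubseteq>\<^bsub>T\<^esub> \<D>\<^bsub>T\<^esub> (F t)"
      using s t in_T by (simp_all add: T.mult_ident_right T.mult_ident_left)
    have "F (meet (category_of S) (\<R>\<^bsub>S\<^esub> s) (\<D>\<^bsub>S\<^esub> t)) =
        meet (category_of T) (F (\<R>\<^bsub>S\<^esub> s)) (F (\<D>\<^bsub>S\<^esub> t))"
      using h s t by (simp add: EOC_hom_def)
    then have Fe: "F ?e = ?f"
      using s t in_T by (simp add: S.meet_category_of T.meet_category_of D R)
    have "F (cores (category_of S) s ?e) = cores (category_of T) (F s) (F ?e)"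
      using h s e by (simp add: EOC_hom_def)
    then have 1: "F (s \<cdot>\<^bsub>S\<^esub> ?e) = F s \<cdot>\<^bsub>T\<^esub> ?f"
      using s e f in_T Fe by (simp add: S.cores_category_of T.cores_category_of)
    have "F (res (category_of S) ?e t) = res (category_of T) (F ?e) (F t)"
      using h t e by (simp add: EOC_hom_def)
    then have 2: "F (?e \<cdot>\<^bsub>S\<^esub> t) = ?f \<cdot>\<^bsub>T\<^esub> F t"
      using t e f in_T Fe by (simp add: S.res_category_of T.res_category_of)
    have "(s \<cdot>\<^bsub>S\<^esub> ?e) \<odot>\<^bsub>category_of S\<^esub> (?e \<cdot>\<^bsub>S\<^esub> t) = Some (s \<cdot>\<^bsub>S\<^esub> t)"
      using s t S.mult_via_overlap[OF s t] by (simp add: pcomp_category_of)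
    then have "F (s \<cdot>\<^bsub>S\<^esub> ?e) \<odot>\<^bsub>category_of T\<^esub> F (?e \<cdot>\<^bsub>S\<^esub> t) = Some (F (s \<cdot>\<^bsub>S\<^esub> t))"
      using fct unfolding is_functor_def by blast
    then have "F (s \<cdot>\<^bsub>S\<^esub> t) = (F s \<cdot>\<^bsub>T\<^esub> ?f) \<cdot>\<^bsub>T\<^esub> (?f \<cdot>\<^bsub>T\<^esub> F t)"
      unfolding 1 2 by (simp add: pcomp_category_of)
    then show ?thesis
      using T.mult_via_overlap(1) s t in_T by simp
  qed
  then show "OES_hom S T F"
    using fct D R mono by (simp add: OES_hom_def is_functor_def)
qed


section \<open>Isomorphisms of categories of structures\<close>

locale concrete_category =
  fixes obj :: "('a, 'b) biunary_scheme \<Rightarrow> bool"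
    and hom :: "('a, 'b) biunary_scheme \<Rightarrow> ('a, 'b) biunary_scheme \<Rightarrow> ('a \<Rightarrow> 'a) \<Rightarrow> bool"
  assumes hom_map: "\<lbrakk>obj X; obj Y; hom X Y F\<rbrakk> \<Longrightarrow> F \<in> carrier X \<rightarrow>\<^sub>E carrier Y"
    and hom_id: "obj X \<Longrightarrow> hom X X (restrict id (carrier X))"
    and hom_compose:
      "\<lbrakk>obj X; obj Y; obj Z; hom X Y F; hom Y Z G\<rbrakk> \<Longrightarrow> hom X Z (compose (carrier X) G F)"

lemma structure_category_carrier:
  "(X, F, Y) \<in> carrier (structure_category obj hom) \<longleftrightarrow> obj X \<and> obj Y \<and> hom X Y F"
  by (simp add: structure_category_def Let_def)

lemma structure_category_D:
  "\<lbrakk>obj X; obj Y; hom X Y F\<rbrakk> \<Longrightarrow>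
    Dop (structure_category obj hom) (X, F, Y) = (X, restrict id (carrier X), X)"
  by (simp add: structure_category_def Let_def)

lemma structure_category_R:
  "\<lbrakk>obj X; obj Y; hom X Y F\<rbrakk> \<Longrightarrow>
    Rop (structure_category obj hom) (X, F, Y) = (Y, restrict id (carrier Y), Y)"
  by (simp add: structure_category_def Let_def)

lemma structure_category_comp:
  "pcomp (structure_category obj hom) (X, F, Y) (Y', G, Z) = Some h \<longleftrightarrow>
    obj X \<and> obj Y \<and> obj Z \<and> hom X Y F \<and> hom Y Z G \<and> Y = Y' \<and>
    h = (X, compose (carrier X) G F, Z)"
  by (auto simp: structure_category_def Let_def)

lemmas structure_category_simps =
  structure_category_carrier structure_category_D structure_category_R structure_category_comp

text \<open>
  Extensionality of the homomorphisms is what makes the unit laws hold as equations between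
  functions: \<open>compose\<close> returns an extensional function.
\<close>

lemma (in concrete_category) category_structure_category:
  "category (structure_category obj hom)"
proof
  let ?C = "structure_category obj hom"
  have ext: "Dop ?C \<in> extensional (carrier ?C)" "Rop ?C \<in> extensional (carrier ?C)"
    by (simp_all add: structure_category_def Let_def)
  show "Dop ?C \<in> carrier ?C \<rightarrow>\<^sub>E carrier ?C"
    using ext hom_id by (auto simp: PiE_def structure_category_simps)
  show "Rop ?C \<in> carrier ?C \<rightarrow>\<^sub>E carrier ?C"
    using ext hom_id by (auto simp: PiE_def structure_category_simps)
  fix x y :: "('a, 'b) biunary_scheme \<times> ('a \<Rightarrow> 'a) \<times> ('a, 'b) biunary_scheme"
  obtain X F Y where x: "x = (X, F, Y)" by (cases x)
  obtain Y' G Z where y: "y = (Y', G, Z)" by (cases y)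
  show "(\<exists>z. pcomp ?C x y = Some z) \<longleftrightarrow> x \<in> carrier ?C \<and> y \<in> carrier ?C \<and> Rop ?C x = Dop ?C y"
    unfolding x y by (auto simp: structure_category_simps)
  show "pcomp ?C (Dop ?C x) x = Some x" if "x \<in> carrier ?C"
    using that hom_id hom_map unfolding x
    by (auto simp: structure_category_simps compose_def PiE_def
        intro!: extensionalityI[of _ "carrier X"])
  show "pcomp ?C x (Rop ?C x) = Some x" if "x \<in> carrier ?C"
    using that hom_id hom_map[of X Y F] unfolding x
    by (auto simp: structure_category_simps compose_def PiE_def Pi_def
        intro!: extensionalityI[of _ "carrier X"])
  show "Dop ?C (Rop ?C x) = Rop ?C x" if "x \<in> carrier ?C"
    using that hom_id unfolding x by (auto simp: structure_category_simps)
  show "Rop ?C (Dop ?C x) = Dop ?C x" if "x \<in> carrier ?C"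
    using that hom_id unfolding x by (auto simp: structure_category_simps)
  fix z
  assume xy: "pcomp ?C x y = Some z"
  then show "z \<in> carrier ?C"
    unfolding x y by (auto simp: structure_category_simps intro: hom_compose)
  show "Dop ?C z = Dop ?C x" "Rop ?C z = Rop ?C y"
    using xy hom_compose unfolding x y
    by (auto simp: structure_category_simps intro: hom_compose)
next
  let ?C = "structure_category obj hom"
  fix x y u z v w v'
  assume *: "pcomp ?C x y = Some u" "pcomp ?C u z = Some v"
    "pcomp ?C y z = Some w" "pcomp ?C x w = Some v'"
  obtain X F Y where x: "x = (X, F, Y)" by (cases x)
  obtain Y' G Z where y: "y = (Y', G, Z)" by (cases y)
  obtain Z' H W where z: "z = (Z', H, W)" by (cases z)
  from * show "v = v'"
    unfolding x y z using hom_map[of X Y F]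
    by (auto simp: structure_category_simps compose_def PiE_def Pi_def)
qed

text \<open>
  Since a map between carriers is a homomorphism on one side exactly when it is on the other, the
  functor acts on arrows by \<open>(X, F, Y) \<mapsto> (\<Phi> X, F, \<Phi> Y)\<close>, and closure of the homomorphisms under
  identities and composition is inherited by the target.
\<close>

locale structure_isomorphism =
  source: concrete_category obj1 hom1
  for obj1 :: "('a, 'b) biunary_scheme \<Rightarrow> bool" and hom1 +
  fixes obj2 :: "('a, 'c) biunary_scheme \<Rightarrow> bool" and hom2
    and \<Phi> :: "('a, 'b) biunary_scheme \<Rightarrow> ('a, 'c) biunary_scheme"
    and \<Psi> :: "('a, 'c) biunary_scheme \<Rightarrow> ('a, 'b) biunary_scheme"
  assumes obj2_image: "obj1 X \<Longrightarrow> obj2 (\<Phi> X)"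
    and obj1_image: "obj2 X' \<Longrightarrow> obj1 (\<Psi> X')"
    and inverse1: "obj1 X \<Longrightarrow> \<Psi> (\<Phi> X) = X"
    and inverse2: "obj2 X' \<Longrightarrow> \<Phi> (\<Psi> X') = X'"
    and same_carrier: "carrier (\<Phi> X) = carrier X"
    and same_homs: "\<lbrakk>obj1 X; obj1 Y\<rbrakk> \<Longrightarrow> hom1 X Y F \<longleftrightarrow> hom2 (\<Phi> X) (\<Phi> Y) F"
begin

lemma same_carrier': "obj2 X \<Longrightarrow> carrier (\<Psi> X) = carrier X"
  using same_carrier[of "\<Psi> X"] by (simp add: inverse2)

lemma same_homs': "\<lbrakk>obj2 X; obj2 Y\<rbrakk> \<Longrightarrow> hom1 (\<Psi> X) (\<Psi> Y) F \<longleftrightarrow> hom2 X Y F"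
  by (simp add: same_homs obj1_image inverse2)

sublocale target: concrete_category obj2 hom2
proof
  fix X Y Z F G
  assume X: "obj2 X"
  then show "hom2 X X (restrict id (carrier X))"
    using source.hom_id[OF obj1_image[OF X]] by (simp add: same_homs' same_carrier')
  assume Y: "obj2 Y" and F: "hom2 X Y F"
  show "F \<in> carrier X \<rightarrow>\<^sub>E carrier Y"
    using source.hom_map[OF obj1_image[OF X] obj1_image[OF Y]] X Y F
    by (simp add: same_homs' same_carrier')
  assume Z: "obj2 Z" and G: "hom2 Y Z G"
  show "hom2 X Z (compose (carrier X) G F)"
    using source.hom_compose[OF obj1_image[OF X] obj1_image[OF Y] obj1_image[OF Z], of F G] X Y Z F G
    by (simp add: same_homs' same_carrier')
qed

theorem isomorphic:
  "isomorphic_categories (structure_category obj1 hom1) (structure_category obj2 hom2)"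
proof -
  let ?C = "structure_category obj1 hom1" and ?E = "structure_category obj2 hom2"
  define F where "F = restrict (\<lambda>(X, f, Y). (\<Phi> X, f, \<Phi> Y)) (carrier ?C)"
  define G where "G = restrict (\<lambda>(X, f, Y). (\<Psi> X, f, \<Psi> Y)) (carrier ?E)"
  have F: "F (X, f, Y) = (\<Phi> X, f, \<Phi> Y)" if "obj1 X" "obj1 Y" "hom1 X Y f" for X f Y
    using that by (simp add: F_def structure_category_simps)
  have G: "G (X, f, Y) = (\<Psi> X, f, \<Psi> Y)" if "obj2 X" "obj2 Y" "hom2 X Y f" for X f Y
    using that by (simp add: G_def structure_category_simps)
  have F_fun: "is_functor ?C ?E F"
    unfolding is_functor_def
  proof (intro conjI ballI allI impI)
    have "F \<in> extensional (carrier ?C)"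
      by (simp add: F_def)
    then show "F \<in> carrier ?C \<rightarrow>\<^sub>E carrier ?E"
      by (auto simp: PiE_def structure_category_simps F obj2_image same_homs[symmetric])
  next
    fix x assume "x \<in> carrier ?C"
    then obtain X f Y where "x = (X, f, Y)" "obj1 X" "obj1 Y" "hom1 X Y f"
      by (cases x) (auto simp: structure_category_simps)
    then show "F (Dop ?C x) = Dop ?E (F x)" "F (Rop ?C x) = Rop ?E (F x)"
      by (simp_all add: structure_category_simps F obj2_image same_homs[symmetric] same_carrier
          source.hom_id)
  next
    fix x y z assume "pcomp ?C x y = Some z"
    then show "pcomp ?E (F x) (F y) = Some (F z)"
      by (cases x; cases y)
        (auto simp: structure_category_simps F obj2_image same_homs[symmetric] same_carrier
          source.hom_compose)
  qed
  have G_fun: "is_functor ?E ?C G"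
    unfolding is_functor_def
  proof (intro conjI ballI allI impI)
    have "G \<in> extensional (carrier ?E)"
      by (simp add: G_def)
    then show "G \<in> carrier ?E \<rightarrow>\<^sub>E carrier ?C"
      by (auto simp: PiE_def structure_category_simps G obj1_image same_homs')
  next
    fix x assume "x \<in> carrier ?E"
    then obtain X f Y where "x = (X, f, Y)" "obj2 X" "obj2 Y" "hom2 X Y f"
      by (cases x) (auto simp: structure_category_simps)
    then show "G (Dop ?E x) = Dop ?C (G x)" "G (Rop ?E x) = Rop ?C (G x)"
      by (simp_all add: structure_category_simps G obj1_image same_homs' same_carrier'
          target.hom_id)
  next
    fix x y z assume "pcomp ?E x y = Some z"
    then show "pcomp ?C (G x) (G y) = Some (G z)"
      by (cases x; cases y)
        (auto simp: structure_category_simps G obj1_image same_homs' same_carrier'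
          target.hom_compose)
  qed
  have "G (F x) = x" if "x \<in> carrier ?C" for x
    using that
    by (cases x) (auto simp: structure_category_simps F G obj2_image same_homs[symmetric] inverse1)
  moreover have "F (G x) = x" if "x \<in> carrier ?E" for x
    using that
    by (cases x) (auto simp: structure_category_simps F G obj1_image same_homs' inverse2)
  ultimately show ?thesis
    unfolding isomorphic_categories_def
    using F_fun G_fun source.category_structure_category target.category_structure_category
    by blast
qed

end

section \<open>The isomorphism between semigroups and categories\<close>

lemma concrete_category_OES:
  "concrete_category (\<lambda>S. ordered_ehresmann_semigroup S \<and> P S) OES_hom"
proof
  fix S assume "ordered_ehresmann_semigroup S \<and> P S"
  then interpret ordered_ehresmann_semigroup S by simp
  show "OES_hom S S (restrict id (carrier S))"
    using sle_carrier by (auto simp: OES_hom_def)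
next
  fix S T U F G
  assume "ordered_ehresmann_semigroup S \<and> P S" "ordered_ehresmann_semigroup T \<and> P T"
  then interpret S: ordered_ehresmann_semigroup S + T: ordered_ehresmann_semigroup T by simp_all
  assume F: "OES_hom S T F" and G: "OES_hom T U G"
  have "s \<in> carrier S \<Longrightarrow> F s \<in> carrier T" "t \<in> carrier T \<Longrightarrow> G t \<in> carrier U" for s t
    using F G by (auto simp: OES_hom_def)
  then show "OES_hom S U (compose (carrier S) G F)"
    using F G S.sle_carrier by (auto simp: OES_hom_def compose_def)
qed (simp add: OES_hom_def)

text \<open>
  The form common to both parts: any two properties that the constructions exchange will do,
  provided the one on the category side is strong enough for associativity.
\<close>

theorem OES_EOC_isomorphic:
  fixes P :: "'a ordered_sgp \<Rightarrow> bool" and Q :: "'a ordered_cat \<Rightarrow> bool"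
  assumes PQ: "\<And>S. \<lbrakk>ordered_ehresmann_semigroup S; P S\<rbrakk> \<Longrightarrow> Q (category_of S)"
    and QP: "\<And>C. \<lbrakk>ehresmann_ordered_category C; Q C\<rbrakk> \<Longrightarrow> P (semigroup_of C)"
    and Q7: "\<And>C. \<lbrakk>ehresmann_ordered_category C; Q C\<rbrakk> \<Longrightarrow> OC7 C"
  shows "isomorphic_categories (OES_category P) (EOC_category Q)"
proof -
  interpret concrete_category "\<lambda>S. ordered_ehresmann_semigroup S \<and> P S" OES_hom
    by (rule concrete_category_OES)
  have of_cat: "ordered_ehresmann_semigroup (semigroup_of C)"
    if "ehresmann_ordered_category C" "Q C" for C
    using that Q7
    by (intro factorising_category.ordered_ehresmann_semigroup_of
        factorising_category.intro factorising_category_axioms.intro)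
  interpret structure_isomorphism "\<lambda>S. ordered_ehresmann_semigroup S \<and> P S" OES_hom
    "\<lambda>C. ehresmann_ordered_category C \<and> Q C" EOC_hom category_of semigroup_of
    by unfold_locales
      (auto simp: PQ QP of_cat category_of_semigroup_of semigroup_of_category_of
        OES_hom_iff_EOC_hom ordered_ehresmann_semigroup.ehresmann_ordered_category_of)
  show ?thesis
    unfolding OES_category_def EOC_category_def by (rule isomorphic)
qed

theorem theorem4p8:
  shows "isomorphic_categories
           (OES_category (OS4 :: 'a ordered_sgp \<Rightarrow> bool))
           (EOC_category (OC4 :: 'a ordered_cat \<Rightarrow> bool)) \<and>
         isomorphic_categories
           (OES_category (OS7 :: 'a ordered_sgp \<Rightarrow> bool))
           (EOC_category (OC7 :: 'a ordered_cat \<Rightarrow> bool))"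
proof
  show "isomorphic_categories (OES_category (OS4 :: 'a ordered_sgp \<Rightarrow> bool))
      (EOC_category (OC4 :: 'a ordered_cat \<Rightarrow> bool))"
    by (rule OES_EOC_isomorphic) (rule OC4_category_of OS4_semigroup_of OC7_if_OC4; assumption)+
  show "isomorphic_categories (OES_category (OS7 :: 'a ordered_sgp \<Rightarrow> bool))
      (EOC_category (OC7 :: 'a ordered_cat \<Rightarrow> bool))"
    by (rule OES_EOC_isomorphic) (rule OC7_category_of OS7_semigroup_of; assumption | assumption)+
qed

end
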